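(* Let $n\ge 1$ and let $B$ be a finite multiset of elements of $\mathfrak{S}_n$. If $B$ is fine, then $B$ is $D$-commutative with all inverse $J$-classes, that is, $BR_J^{-1}\equiv R_J^{-1}B$ for all $J\subseteq[n-1]$.
   Context: $[n]=\{1,\dots,n\}$ and $\mathfrak{S}_n$ is the symmetric group on $[n]$; the product is composition, $(\pi\tau)_i=\pi_{\tau_i}$. For $\pi\in\mathfrak{S}_n$, $\mathrm{Des}(\pi)=\{i\in[n-1]:\pi_i>\pi_{i+1}\}$. For $J\subseteq[n-1]$, the inverse $J$-class is $R_J^{-1}=\{\pi^{-1}:\pi\in\mathfrak{S}_n,\ \mathrm{Des}(\pi)\subseteq J\}$. For multisets $A,B$ of elements of $\mathfrak{S}_n$, $AB$ is the multiset of all products $\pi\tau$ with $\pi\in A,\tau\in B$ (with multiplicity), and $A\equiv B$ means there is a bijection between $A$ and $B$ (repeated elements treated as distinct copies) preserving descent sets. For $J=\{j_1<\dots<j_s\}\subseteq[n-1]$, $\mathrm{co}(J)=(j_1,j_2-j_1,\dots,j_s-j_{s-1},n-j_s)$, a composition of $n$. For a composition $\alpha=(\alpha_1,\dots,\alpha_p)$ of $n$, $M_\alpha=\sum_{i_1<\cdots<i_p}x_{i_1}^{\alpha_1}\cdots x_{i_p}^{\alpha_p}$ and $F_\alpha=\sum_{\beta\le\alpha}M_\beta$ over all refinements $\beta$ of $\alpha$ (including $\alpha$). $F_{J,n}:=F_{\mathrm{co}(J)}$ and $Q(B)=\sum_{\pi\in B}F_{\mathrm{Des}(\pi),n}$ (with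 multiplicity). $B$ is fine if $Q(B)$ is symmetric and Schur-positive, i.e. $Q(B)=\sum_{\lambda\vdash n}c_\lambda s_\lambda$ with all $c_\lambda$ nonnegative integers, where $s_\lambda$ are the Schur functions. *)

theory Defs
  imports "HOL-Library.Multiset" "HOL-Library.FuncSet" "HOL-Library.Poly_Mapping"
    "HOL-Combinatorics.Permutations"
begin

section \<open>Permutations, descents and \<open>D\<close>-commutativity\<close>

definition sym_grp :: "nat \<Rightarrow> (nat \<Rightarrow> nat) set" where
  "sym_grp n = {\<pi>. \<pi> permutes {1..n}}"

definition Des :: "nat \<Rightarrow> (nat \<Rightarrow> nat) \<Rightarrow> nat set" where
  "Des n \<pi> = {i \<in> {1..n - 1}. \<pi> i > \<pi> (i + 1)}"

definition inv_J_class :: "nat \<Rightarrow> nat set \<Rightarrow> (nat \<Rightarrow> nat) set" where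
  "inv_J_class n J = {inv \<pi> |\<pi>. \<pi> \<in> sym_grp n \<and> Des n \<pi> \<subseteq> J}"

definition mset_prod :: "(nat \<Rightarrow> nat) multiset \<Rightarrow> (nat \<Rightarrow> nat) multiset \<Rightarrow> (nat \<Rightarrow> nat) multiset" where
  "mset_prod A B = (\<Sum>\<pi>\<in>#A. {# \<pi> \<circ> \<tau>. \<tau> \<in># B #})"

text \<open>The elements of a multiset, with repeated elements made into distinct copies.\<close>

definition mset_copies :: "'a multiset \<Rightarrow> ('a \<times> nat) set" where
  "mset_copies A = {(a, k). k < count A a}"

definition D_equiv :: "nat \<Rightarrow> (nat \<Rightarrow> nat) multiset \<Rightarrow> (nat \<Rightarrow> nat) multiset \<Rightarrow> bool" where
  "D_equiv n A B \<longleftrightarrow>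
     (\<exists>f. bij_betw f (mset_copies A) (mset_copies B) \<and>
          (\<forall>x \<in> mset_copies A. Des n (fst (f x)) = Des n (fst x)))"

definition D_commutative :: "nat \<Rightarrow> (nat \<Rightarrow> nat) multiset \<Rightarrow> (nat \<Rightarrow> nat) multiset \<Rightarrow> bool" where
  "D_commutative n A B \<longleftrightarrow> D_equiv n (mset_prod A B) (mset_prod B A)"


section \<open>Compositions and partitions\<close>

definition compositions :: "nat \<Rightarrow> nat list set" where
  "compositions n = {\<alpha>. (\<forall>a \<in> set \<alpha>. 0 < a) \<and> sum_list \<alpha> = n}"

text \<open>
  For \<open>J = {j\<^sub>1 < \<dots> < j\<^sub>s}\<close> this subtracts \<open>[0, j\<^sub>1, \<dots>, j\<^sub>s]\<close> from \<open>[j\<^sub>1, \<dots>, j\<^sub>s, n]\<close> entrywise; no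
  subtraction is truncated when \<open>J \<subseteq> {1..n - 1}\<close>.
\<close>

definition co :: "nat \<Rightarrow> nat set \<Rightarrow> nat list" where
  "co n J = (let js = sorted_list_of_set J in map2 (-) (js @ [n]) (0 # js))"

definition refines :: "nat list \<Rightarrow> nat list \<Rightarrow> bool" where
  "refines \<beta> \<alpha> \<longleftrightarrow> (\<exists>bs. concat bs = \<beta> \<and> map sum_list bs = \<alpha>)"

definition int_partitions :: "nat \<Rightarrow> nat list set" where
  "int_partitions n = {\<mu>. sorted_wrt (\<ge>) \<mu> \<and> (\<forall>a \<in> set \<mu>. 0 < a) \<and> sum_list \<mu> = n}"


section \<open>Formal power series in infinitely many variables\<close>

text \<open>
  A monomial in the variables \<open>x\<^sub>0, x\<^sub>1, x\<^sub>2, \<dots>\<close> (numbered from 0) is given by its finitely supported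
  exponent vector, and a formal power series with integer coefficients by its coefficient function.
\<close>

type_synonym monom = "nat \<Rightarrow>\<^sub>0 nat"
type_synonym mpower_series = "monom \<Rightarrow> int"

text \<open>
  The formal sum \<open>\<Sum>t \<in> S. w t\<close> of monomials. It is only meaningful if each monomial arises from
  finitely many \<open>t \<in> S\<close>. Below this holds for tableaux, and for \<open>monomial_qsym \<alpha>\<close> when the
  entries of \<open>\<alpha>\<close> are positive, i.e. when \<open>\<alpha>\<close> is a composition.
\<close>

definition monom_sum :: "'a set \<Rightarrow> ('a \<Rightarrow> monom) \<Rightarrow> mpower_series" where
  "monom_sum S w = (\<lambda>m. int (card {t \<in> S. w t = m}))"

definition symmetric_series :: "mpower_series \<Rightarrow> bool" where
  "symmetric_series f \<longleftrightarrow> (\<forall>\<sigma>. bij \<sigma> \<longrightarrow> (\<forall>m. f (Poly_Mapping.map_key \<sigma> m) = f m))"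

definition monomial_qsym :: "nat list \<Rightarrow> mpower_series" where
  "monomial_qsym \<alpha> =
     monom_sum {ks. length ks = length \<alpha> \<and> sorted_wrt (<) ks}
       (\<lambda>ks. \<Sum>k<length \<alpha>. Poly_Mapping.single (ks ! k) (\<alpha> ! k))"

definition fundamental_qsym :: "nat list \<Rightarrow> mpower_series" where
  "fundamental_qsym \<alpha> =
     (\<lambda>m. \<Sum>\<beta> | \<beta> \<in> compositions (sum_list \<alpha>) \<and> refines \<beta> \<alpha>. monomial_qsym \<beta> m)"

definition qsym_mset :: "nat \<Rightarrow> (nat \<Rightarrow> nat) multiset \<Rightarrow> mpower_series" where
  "qsym_mset n B = (\<lambda>m. \<Sum>\<pi>\<in>#B. fundamental_qsym (co n (Des n \<pi>)) m)"

text \<open>Schur functions as generating functions of semistandard Young tableaux.\<close>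

definition young_diagram :: "nat list \<Rightarrow> (nat \<times> nat) set" where
  "young_diagram \<mu> = {(i, j). i < length \<mu> \<and> j < \<mu> ! i}"

definition ssyt :: "nat list \<Rightarrow> (nat \<times> nat \<Rightarrow> nat) set" where
  "ssyt \<mu> = {T \<in> young_diagram \<mu> \<rightarrow>\<^sub>E UNIV.
     (\<forall>i j. (i, j + 1) \<in> young_diagram \<mu> \<longrightarrow> T (i, j) \<le> T (i, j + 1)) \<and>
     (\<forall>i j. (i + 1, j) \<in> young_diagram \<mu> \<longrightarrow> T (i, j) < T (i + 1, j))}"

definition schur_function :: "nat list \<Rightarrow> mpower_series" where
  "schur_function \<mu> =
     monom_sum (ssyt \<mu>) (\<lambda>T. \<Sum>c\<in>young_diagram \<mu>. Poly_Mapping.single (T c) 1)"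

definition schur_positive :: "nat \<Rightarrow> mpower_series \<Rightarrow> bool" where
  "schur_positive n f \<longleftrightarrow>
     (\<exists>c :: nat list \<Rightarrow> int. (\<forall>\<mu> \<in> int_partitions n. 0 \<le> c \<mu>) \<and>
        f = (\<lambda>m. \<Sum>\<mu>\<in>int_partitions n. c \<mu> * schur_function \<mu> m))"

definition fine_mset :: "nat \<Rightarrow> (nat \<Rightarrow> nat) multiset \<Rightarrow> bool" where
  "fine_mset n B \<longleftrightarrow> symmetric_series (qsym_mset n B) \<and> schur_positive n (qsym_mset n B)"

end

theory Submission imports Defs begin

text \<open>
  Write \<open>R\<^sub>J\<close> for the set of permutations of \<open>{1..n}\<close> whose descents lie in \<open>J\<close>, and \<open>Q(B)\<close> for
  \<open>qsym_mset n B\<close>. Two multisets of permutations are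
  descent-equivalent as soon as, for every \<open>D\<close>, they have the same number of elements with descent
  set inside \<open>D\<close>: Moebius inversion over subsets then gives the number of elements with each exact
  descent set (\<open>sizes_by_descents_eqI\<close>, \<open>D_equivI\<close>).

  For a single \<open>\<pi>\<close>, the elements of \<open>\<pi> R\<^sub>J\<inverse>\<close> with descents in \<open>D\<close> correspond to factorisations
  \<open>\<pi> = w \<circ> \<sigma>\<close> with \<open>w \<in> R\<^sub>D\<close> and \<open>\<sigma> \<in> R\<^sub>J\<close>. The elements of \<open>R\<^sub>J\<inverse> \<pi>\<close> with descents in \<open>D\<close> correspond
  to factorisations of the same kind with \<open>J\<close> and \<open>D\<close> exchanged. So the theorem says that the number
  of factorisations, summed over \<open>\<pi> \<in> B\<close>, is symmetric in \<open>J\<close> and \<open>D\<close>.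

  The set \<open>J\<close> cuts \<open>{1..n}\<close> into consecutive blocks, and so does \<open>D\<close>. A factorisation determines a
  table: entry \<open>(j, d)\<close> counts the positions \<open>i\<close> in block \<open>j\<close> of \<open>J\<close> for which \<open>\<sigma> i\<close> is in block \<open>d\<close>
  of \<open>D\<close>. Its row and column sums are the block sizes. The factorisation can be recovered from \<open>\<pi>\<close>
  and the table, and a table with these margins occurs exactly if \<open>\<pi>\<close> has no descent inside any of
  the segments of \<open>{1..n}\<close> whose lengths are the entries of the table read row by row
  (\<open>card_factors\<close>). This is the multiplication rule of Solomon's descent algebra. Now regard the
  table as a monomial in variables indexed by the pairs \<open>(j, d)\<close>, ordered lexicographically. The
  condition on \<open>\<pi>\<close> then says that the coefficient of this monomial in the fundamental quasisymmetric
  function of \<open>\<pi>\<close> is 1 rather than 0 (\<open>fundamental_qsym_coeff\<close>). Hence the number of factorisations,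
  summed over \<open>B\<close>, is the sum of the coefficients of \<open>Q(B)\<close> over all tables (\<open>sum_card_factors\<close>).

  Exchanging \<open>J\<close> and \<open>D\<close> transposes the tables, that is, it permutes the variables. Since \<open>Q(B)\<close> is
  symmetric, its coefficients do not change (\<open>sum_card_factors_commute\<close>).
\<close>

section \<open>Blocks and weakly increasing words\<close>

text \<open>
  The blocks of \<open>J\<close> are the maximal intervals \<open>{i..k}\<close> with no element of \<open>J\<close> in \<open>{i..<k}\<close>; they are
  numbered from 0.
\<close>

definition block :: "nat set \<Rightarrow> nat \<Rightarrow> nat" where
  "block J i = card {j \<in> J. j < i}"

text \<open>
  For a weakly increasing word \<open>g\<close>, this is the condition that \<open>g\<close> contributes a monomial to the
  fundamental quasisymmetric function of \<open>\<pi>\<close>. For \<open>g = block J\<close> it says that the descents of \<open>\<pi>\<close> lie in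
  \<open>J\<close>. Treating both as one condition is what links factorisations with monomials.
\<close>

definition fibrewise_increasing :: "nat \<Rightarrow> (nat \<Rightarrow> nat) \<Rightarrow> (nat \<Rightarrow> nat) \<Rightarrow> bool" where
  "fibrewise_increasing n g \<pi> \<longleftrightarrow> (\<forall>i \<in> {1..n}. \<forall>k \<in> {1..n}. i < k \<longrightarrow> g i = g k \<longrightarrow> \<pi> i \<le> \<pi> k)"

lemma block_mono: "finite J \<Longrightarrow> i \<le> k \<Longrightarrow> block J i \<le> block J k"
  unfolding block_def by (rule card_mono) auto

lemma block_less_Suc_iff:
  assumes "finite J" shows "block J s < block J (s + 1) \<longleftrightarrow> s \<in> J"
proof -
  have "{j \<in> J. j < s + 1} = (if s \<in> J then insert s {j \<in> J. j < s} else {j \<in> J. j < s})"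
    by (auto simp: less_Suc_eq)
  then show ?thesis using assms unfolding block_def by auto
qed

lemma block_less:
  assumes "1 \<le> n" "J \<subseteq> {1..n - 1}" shows "block J i < n"
proof -
  have "card {j \<in> J. j < i} \<le> card {1..n - 1}"
    by (rule card_mono) (use assms in auto)
  then show ?thesis using assms(1) unfolding block_def by simp
qed

lemma fibrewise_increasing_iff:
  assumes "mono_on {1..n} g"
  shows "fibrewise_increasing n g \<pi> \<longleftrightarrow> (\<forall>s \<in> Des n \<pi>. g s < g (s + 1))"
proof
  assume c: "fibrewise_increasing n g \<pi>"
  show "\<forall>s \<in> Des n \<pi>. g s < g (s + 1)"
  proof
    fix s assume s: "s \<in> Des n \<pi>"
    then have r: "s \<in> {1..n}" "s + 1 \<in> {1..n}" and d: "\<pi> s > \<pi> (s + 1)" by (auto simp: Des_def)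
    have "g s \<le> g (s + 1)" using mono_onD[OF assms r] by simp
    moreover have "g s \<noteq> g (s + 1)" using c r d unfolding fibrewise_increasing_def by fastforce
    ultimately show "g s < g (s + 1)" by simp
  qed
next
  assume a: "\<forall>s \<in> Des n \<pi>. g s < g (s + 1)"
  show "fibrewise_increasing n g \<pi>"
    unfolding fibrewise_increasing_def
  proof (intro ballI impI)
    fix i k assume i: "i \<in> {1..n}" and k: "k \<in> {1..n}" and ik: "i < k" and e: "g i = g k"
    have "\<pi> i \<le> \<pi> l" if "i \<le> l" "l \<le> k" for l
      using that
    proof (induction l rule: dec_induct)
      case base then show ?case by simp
    next
      case (step l)
      have r: "l \<in> {1..n}" "l + 1 \<in> {1..n}" using step i k by auto
      have "g i \<le> g l" "g (l + 1) \<le> g k"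
        using mono_onD[OF assms i r(1)] mono_onD[OF assms r(2) k] step by auto
      then have "l \<notin> Des n \<pi>" using a e by auto
      then have "\<pi> l \<le> \<pi> (l + 1)" using r by (auto simp: Des_def)
      then show ?case using step by simp
    qed
    then show "\<pi> i \<le> \<pi> k" using ik by simp
  qed
qed

lemma Des_subset_iff_block:
  assumes "J \<subseteq> {1..n - 1}"
  shows "Des n \<pi> \<subseteq> J \<longleftrightarrow> fibrewise_increasing n (block J) \<pi>"
proof -
  have f: "finite J" using assms finite_subset by blast
  have "mono_on {1..n} (block J)" using block_mono[OF f] by (auto intro: mono_onI)
  then show ?thesis using fibrewise_increasing_iff block_less_Suc_iff[OF f] by auto
qed

text \<open>
  In a weakly increasing word the letters below \<open>t\<close> fill an initial segment of the positions.
\<close>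

lemma less_iff_le_count:
  fixes g :: "nat \<Rightarrow> nat"
  assumes m: "mono_on {1..n} g" and i: "i \<in> {1..n}"
  shows "g i < t \<longleftrightarrow> i \<le> card {k \<in> {1..n}. g k < t}"
proof
  assume "g i < t"
  then have "{1..i} \<subseteq> {k \<in> {1..n}. g k < t}"
    using i mono_onD[OF m _ i] by (fastforce intro: le_less_trans)
  then have "card {1..i} \<le> card {k \<in> {1..n}. g k < t}" by (rule card_mono[rotated]) simp
  then show "i \<le> card {k \<in> {1..n}. g k < t}" by simp
next
  assume a: "i \<le> card {k \<in> {1..n}. g k < t}"
  show "g i < t"
  proof (rule ccontr)
    assume n: "\<not> g i < t"
    have "k < i" if "k \<in> {1..n}" "g k < t" for k
    proof (rule ccontr)
      assume "\<not> k < i"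
      then have "g i \<le> g k" using mono_onD[OF m i that(1)] by simp
      then show False using that n by simp
    qed
    then have "{k \<in> {1..n}. g k < t} \<subseteq> {1..<i}" by auto
    then have "card {k \<in> {1..n}. g k < t} \<le> card {1..<i}" by (rule card_mono[rotated]) simp
    also have "\<dots> < i" using i by simp
    finally show False using a by simp
  qed
qed

definition content :: "nat \<Rightarrow> (nat \<Rightarrow> nat) \<Rightarrow> nat multiset" where
  "content n g = image_mset g (mset_set {1..n})"

lemma size_filter_content: "size (filter_mset P (content n g)) = card {i \<in> {1..n}. P (g i)}"
  by (simp add: content_def filter_mset_image_mset filter_mset_mset_set)

text \<open>
  A weakly increasing word is the sorted arrangement of its letters.
\<close>

lemma mono_content_unique:
  assumes "mono_on {1..n} g" "mono_on {1..n} h" "content n g = content n h" "i \<in> {1..n}"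
  shows "g i = h i"
proof -
  have "card {k \<in> {1..n}. g k < t} = card {k \<in> {1..n}. h k < t}" for t
    using size_filter_content[of "\<lambda>x. x < t" n] assms(3) by metis
  then have "g i < t \<longleftrightarrow> h i < t" for t
    using less_iff_le_count[OF assms(1,4)] less_iff_le_count[OF assms(2,4)] by simp
  then show ?thesis by (metis nat_neq_iff)
qed

lemma content_cong: "(\<And>i. i \<in> {1..n} \<Longrightarrow> g i = h i) \<Longrightarrow> content n g = content n h"
  unfolding content_def by (rule image_mset_cong) auto

lemma content_permute:
  assumes "\<sigma> permutes {1..n}" shows "content n (\<lambda>i. g (\<sigma> i)) = content n g"
proof -
  have "image_mset \<sigma> (mset_set {1..n}) = mset_set {1..n}"
    using assms permutes_image[OF assms] by (simp add: image_mset_mset_set permutes_inj_on permutes_image)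
  then have "image_mset g (image_mset \<sigma> (mset_set {1..n})) = content n g"
    by (simp add: content_def)
  then show ?thesis by (simp add: content_def multiset.map_comp comp_def)
qed

lemma image_mset_content: "image_mset f (content n g) = content n (\<lambda>i. f (g i))"
  by (simp add: content_def multiset.map_comp comp_def)

lemma mono_content_exists:
  assumes "size M = n"
  obtains g where "mono_on {1..n} g" "content n g = M"
proof
  let ?xs = "sorted_list_of_multiset M"
  let ?g = "\<lambda>i. ?xs ! (i - 1)"
  have l: "length ?xs = n" using assms by (metis mset_sorted_list_of_multiset size_mset)
  show "mono_on {1..n} ?g"
    using l by (intro mono_onI sorted_nth_mono) auto
  have "content n ?g = image_mset ?g (image_mset Suc (mset_set {0..<n}))"
    unfolding content_def by (simp add: image_mset_mset_set atLeastLessThanSuc_atLeastAtMost)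
  also have "\<dots> = image_mset ((!) ?xs) (mset_set {0..<length ?xs})"
    by (simp add: multiset.map_comp comp_def l)
  also have "\<dots> = mset ?xs" by (metis mset_map mset_upt map_nth)
  finally show "content n ?g = M" by simp
qed

text \<open>
  The permutation sends each position to the rank of its key.
\<close>

lemma ranking_permutation:
  fixes e :: "nat \<Rightarrow> nat"
  assumes e: "inj_on e {1..n}"
  obtains \<sigma> where "\<sigma> permutes {1..n}" "\<And>i k. i \<in> {1..n} \<Longrightarrow> k \<in> {1..n} \<Longrightarrow> \<sigma> i < \<sigma> k \<longleftrightarrow> e i < e k"
proof
  let ?\<sigma> = "\<lambda>i. if i \<in> {1..n} then card {k \<in> {1..n}. e k \<le> e i} else i"
  have less: "?\<sigma> i < ?\<sigma> k" if "i \<in> {1..n}" "k \<in> {1..n}" "e i < e k" for i k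
  proof -
    have "{l \<in> {1..n}. e l \<le> e i} \<subset> {l \<in> {1..n}. e l \<le> e k}"
    proof
      show "{l \<in> {1..n}. e l \<le> e i} \<subseteq> {l \<in> {1..n}. e l \<le> e k}" using that(3) by auto
      have "k \<in> {l \<in> {1..n}. e l \<le> e k}" "k \<notin> {l \<in> {1..n}. e l \<le> e i}" using that by auto
      then show "{l \<in> {1..n}. e l \<le> e i} \<noteq> {l \<in> {1..n}. e l \<le> e k}" by blast
    qed
    then show ?thesis using that(1,2) by (simp add: psubset_card_mono)
  qed
  have dist: "e i \<noteq> e k" if "i \<in> {1..n}" "k \<in> {1..n}" "i \<noteq> k" for i k
    using that inj_onD[OF e] by blast
  show iff: "?\<sigma> i < ?\<sigma> k \<longleftrightarrow> e i < e k" if ik: "i \<in> {1..n}" "k \<in> {1..n}" for i k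
  proof (cases "i = k")
    case False
    from dist[OF ik this] consider "e i < e k" | "e k < e i" by linarith
    then show ?thesis
    proof cases
      case 1
      with less[OF ik] show ?thesis by blast
    next
      case 2
      with less[OF ik(2,1)] have "?\<sigma> k < ?\<sigma> i" by blast
      with 2 show ?thesis by linarith
    qed
  qed simp
  have inj: "inj_on ?\<sigma> {1..n}"
  proof (rule inj_onI, rule ccontr)
    fix i k assume ik: "i \<in> {1..n}" "k \<in> {1..n}" "?\<sigma> i = ?\<sigma> k" "i \<noteq> k"
    from dist[OF ik(1,2,4)] show False using iff[OF ik(1,2)] iff[OF ik(2,1)] ik(3) by linarith
  qed
  have im: "?\<sigma> ` {1..n} \<subseteq> {1..n}"
  proof
    fix y assume "y \<in> ?\<sigma> ` {1..n}"
    then obtain i where i: "i \<in> {1..n}" and y: "y = card {k \<in> {1..n}. e k \<le> e i}" by auto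
    have "card {i} \<le> y" unfolding y by (rule card_mono) (use i in auto)
    moreover have "y \<le> card {1..n}" unfolding y by (rule card_mono) auto
    ultimately show "y \<in> {1..n}" by simp
  qed
  have "?\<sigma> ` {1..n} = {1..n}" by (rule endo_inj_surj[OF _ im inj]) simp
  then have "bij_betw ?\<sigma> {1..n} {1..n}" using inj by (simp add: bij_betw_def)
  then show "?\<sigma> permutes {1..n}" by (rule bij_imp_permutes) auto
qed

section \<open>Factorisations and tables\<close>

text \<open>
  With second components below \<open>n\<close>, the map \<open>(j, j') \<mapsto> j * n + j'\<close> turns the lexicographic order on
  pairs into the order on natural numbers, which is the order of the variables of a power series.
\<close>

lemma code_less: "j' < n \<Longrightarrow> j < (k::nat) \<Longrightarrow> j * n + j' < k * n + k'"
proof -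
  assume "j' < n" "j < k"
  then have "j * n + j' < Suc j * n" by simp
  also have "\<dots> \<le> k * n" using \<open>j < k\<close> by (intro mult_le_mono1) simp
  finally show ?thesis by simp
qed

lemma code_mono:
  assumes "j \<le> k" "j = k \<Longrightarrow> j' \<le> k'" "j' < (n::nat)"
  shows "j * n + j' \<le> k * n + k'"
  using assms code_less[of j' n j k k'] by (cases "j = k") auto

text \<open>
  Block numbers are at most \<open>n - 1\<close>, so this number encodes the pair of a block of \<open>J\<close> and a block
  of \<open>D\<close>.
\<close>

definition cell :: "nat \<Rightarrow> nat set \<Rightarrow> nat set \<Rightarrow> (nat \<Rightarrow> nat) \<Rightarrow> nat \<Rightarrow> nat" where
  "cell n J D \<sigma> i = block J i * n + block D (\<sigma> i)"

text \<open>
  A factorisation \<open>\<pi> = w \<circ> \<sigma>\<close> with \<open>Des n w \<subseteq> D\<close> and \<open>Des n \<sigma> \<subseteq> J\<close> is represented by its right factor \<open>\<sigma>\<close>,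
  which determines \<open>w\<close>.
\<close>

definition factors :: "nat \<Rightarrow> nat set \<Rightarrow> nat set \<Rightarrow> (nat \<Rightarrow> nat) \<Rightarrow> (nat \<Rightarrow> nat) set" where
  "factors n J D \<pi> = {\<sigma> \<in> sym_grp n. Des n \<sigma> \<subseteq> J \<and> Des n (\<pi> \<circ> inv \<sigma>) \<subseteq> D}"

text \<open>
  A table of nonnegative integers is represented by the multiset in which the code of a cell has the
  entry of that cell as its multiplicity. Letting \<open>\<sigma>\<close> run over all permutations gives all tables whose
  row and column sums are the sizes of the blocks of \<open>J\<close> and of \<open>D\<close>.
\<close>

definition tables :: "nat \<Rightarrow> nat set \<Rightarrow> nat set \<Rightarrow> nat multiset set" where
  "tables n J D = (\<lambda>\<sigma>. content n (cell n J D \<sigma>)) ` sym_grp n"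

text \<open>
  The sorted arrangement of \<open>M\<close> is constant on consecutive segments of \<open>{1..n}\<close>; the condition is that
  \<open>\<pi>\<close> increases on each of them.
\<close>

definition fits :: "nat \<Rightarrow> (nat \<Rightarrow> nat) \<Rightarrow> nat multiset \<Rightarrow> bool" where
  "fits n \<pi> M \<longleftrightarrow> (\<exists>g. mono_on {1..n} g \<and> content n g = M \<and> fibrewise_increasing n g \<pi>)"

lemma permutes_in_range: "\<sigma> permutes {1..n} \<Longrightarrow> i \<in> {1..n} \<Longrightarrow> \<sigma> i \<in> {1..n}"
  by (simp only: permutes_in_image)

text \<open>
  On a block of \<open>J\<close> the permutation \<open>\<sigma>\<close> increases, hence so does the second component of the cell. On
  positions with the same cell, \<open>\<sigma>\<close> increases and takes its values in one block of \<open>D\<close>, on which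
  \<open>\<pi> \<circ> inv \<sigma>\<close> increases.
\<close>

lemma cell_mono_and_fibrewise_increasing:
  assumes n: "1 \<le> n" and J: "J \<subseteq> {1..n - 1}" and D: "D \<subseteq> {1..n - 1}"
    and \<pi>: "\<pi> \<in> sym_grp n" and \<sigma>: "\<sigma> \<in> factors n J D \<pi>"
  shows "mono_on {1..n} (cell n J D \<sigma>)" "fibrewise_increasing n (cell n J D \<sigma>) \<pi>"
proof -
  have fin: "finite J" "finite D" using J D finite_subset by blast+
  have p: "\<sigma> permutes {1..n}" and c: "fibrewise_increasing n (block J) \<sigma>" "fibrewise_increasing n (block D) (\<pi> \<circ> inv \<sigma>)"
    using \<sigma> by (auto simp: factors_def sym_grp_def Des_subset_iff_block[OF J] Des_subset_iff_block[OF D])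
  have lt: "block D x < n" for x using block_less[OF n D] .
  show "mono_on {1..n} (cell n J D \<sigma>)"
  proof (rule mono_onI)
    fix i k assume ik: "i \<in> {1..n}" "k \<in> {1..n}" "i \<le> k"
    show "cell n J D \<sigma> i \<le> cell n J D \<sigma> k"
      unfolding cell_def
    proof (rule code_mono)
      show "block J i \<le> block J k" using block_mono[OF fin(1) ik(3)] .
      assume "block J i = block J k"
      then have "\<sigma> i \<le> \<sigma> k" using c(1) ik by (cases "i = k") (auto simp: fibrewise_increasing_def)
      then show "block D (\<sigma> i) \<le> block D (\<sigma> k)" using block_mono[OF fin(2)] by blast
    qed (rule lt)
  qed
  show "fibrewise_increasing n (cell n J D \<sigma>) \<pi>"
    unfolding fibrewise_increasing_def
  proof (intro ballI impI)
    fix i k assume ik: "i \<in> {1..n}" "k \<in> {1..n}" "i < k" "cell n J D \<sigma> i = cell n J D \<sigma> k"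
    have e: "block J i = block J k" "block D (\<sigma> i) = block D (\<sigma> k)"
      using arg_cong[OF ik(4), of "\<lambda>x. x div n"] arg_cong[OF ik(4), of "\<lambda>x. x mod n"] lt n
      by (simp_all add: cell_def)
    have "\<sigma> i \<noteq> \<sigma> k" using ik(3) permutes_inj[OF p] by (metis injD less_irrefl)
    moreover have "\<sigma> i \<le> \<sigma> k" using c(1) ik e(1) by (auto simp: fibrewise_increasing_def)
    ultimately have "(\<pi> \<circ> inv \<sigma>) (\<sigma> i) \<le> (\<pi> \<circ> inv \<sigma>) (\<sigma> k)"
      using c(2) e(2) permutes_in_range[OF p] ik by (auto simp: fibrewise_increasing_def)
    then show "\<pi> i \<le> \<pi> k" using permutes_inverses[OF p] by simp
  qed
qed

lemma permutes_eqI: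
  assumes \<sigma>: "\<sigma> permutes {1..n}" and \<tau>: "\<tau> permutes {1..n::nat}"
    and less: "\<And>i k. i \<in> {1..n} \<Longrightarrow> k \<in> {1..n} \<Longrightarrow> \<sigma> i < \<sigma> k \<Longrightarrow> \<tau> i < \<tau> k"
  shows "\<sigma> = \<tau>"
proof
  fix i
  have inv: "inv \<sigma> permutes {1..n}" using permutes_inv[OF \<sigma>] .
  have comp: "\<tau> \<circ> inv \<sigma> permutes {1..n}" using permutes_compose[OF inv \<tau>] .
  have "mono_on {1..n} (\<tau> \<circ> inv \<sigma>)"
  proof (rule mono_onI)
    fix a c assume ac: "a \<in> {1..n}" "c \<in> {1..n}" "a \<le> c"
    show "(\<tau> \<circ> inv \<sigma>) a \<le> (\<tau> \<circ> inv \<sigma>) c"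
    proof (cases "a = c")
      case False
      then show ?thesis
        using less[of "inv \<sigma> a" "inv \<sigma> c"] ac permutes_in_range[OF inv] permutes_inverses[OF \<sigma>] by fastforce
    qed simp
  qed
  moreover have "mono_on {1..n} (\<lambda>x. x)" by (rule mono_onI)
  moreover have "content n (\<tau> \<circ> inv \<sigma>) = content n (\<lambda>x. x)"
    using content_permute[OF comp, of "\<lambda>x. x"] by (simp add: comp_def)
  ultimately have fixed: "(\<tau> \<circ> inv \<sigma>) x = x" if "x \<in> {1..n}" for x
    using mono_content_unique that by blast
  show "\<sigma> i = \<tau> i"
  proof (cases "i \<in> {1..n}")
    case True
    then show ?thesis using fixed[OF permutes_in_range[OF \<sigma> True]] permutes_inverses[OF \<sigma>] by simp
  next
    case False
    then show ?thesis using \<sigma> \<tau> by (metis permutes_not_in)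
  qed
qed

text \<open>
  The table determines the sorted word of cells, and so the block of \<open>D\<close> that contains \<open>\<sigma> i\<close>, for each
  \<open>i\<close>. Within a block of \<open>D\<close> the values of \<open>\<sigma>\<close> are ordered as those of \<open>\<pi>\<close>.
\<close>

lemma inj_on_factors:
  assumes n: "1 \<le> n" and J: "J \<subseteq> {1..n - 1}" and D: "D \<subseteq> {1..n - 1}" and \<pi>: "\<pi> \<in> sym_grp n"
  shows "inj_on (\<lambda>\<sigma>. content n (cell n J D \<sigma>)) (factors n J D \<pi>)"
proof (rule inj_onI)
  fix \<sigma> \<tau> assume \<sigma>: "\<sigma> \<in> factors n J D \<pi>" and \<tau>: "\<tau> \<in> factors n J D \<pi>"
    and eq: "content n (cell n J D \<sigma>) = content n (cell n J D \<tau>)"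
  have fin: "finite D" using D finite_subset by blast
  have p\<pi>: "\<pi> permutes {1..n}" using \<pi> by (simp add: sym_grp_def)
  have p: "\<rho> permutes {1..n}" "fibrewise_increasing n (block D) (\<pi> \<circ> inv \<rho>)" if "\<rho> \<in> factors n J D \<pi>" for \<rho>
    using that by (auto simp: factors_def sym_grp_def Des_subset_iff_block[OF D])
  have b: "block D (\<sigma> i) = block D (\<tau> i)" if "i \<in> {1..n}" for i
    using mono_content_unique[OF cell_mono_and_fibrewise_increasing(1)[OF n J D \<pi> \<sigma>]
        cell_mono_and_fibrewise_increasing(1)[OF n J D \<pi> \<tau>] eq that] by (simp add: cell_def)
  have ord: "\<pi> i < \<pi> k"
    if "\<rho> \<in> factors n J D \<pi>" "i \<in> {1..n}" "k \<in> {1..n}" "block D (\<rho> i) = block D (\<rho> k)" "\<rho> i < \<rho> k"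
    for \<rho> i k
  proof -
    have "(\<pi> \<circ> inv \<rho>) (\<rho> i) \<le> (\<pi> \<circ> inv \<rho>) (\<rho> k)"
      using p(2)[OF that(1)] permutes_in_range[OF p(1)[OF that(1)]] that unfolding fibrewise_increasing_def by blast
    then have "\<pi> i \<le> \<pi> k" using permutes_inverses[OF p(1)[OF that(1)]] by simp
    moreover have "\<pi> i \<noteq> \<pi> k" using that(5) permutes_inj[OF p\<pi>] by (metis injD less_irrefl)
    ultimately show ?thesis by simp
  qed
  show "\<sigma> = \<tau>"
  proof (rule permutes_eqI[OF p(1)[OF \<sigma>] p(1)[OF \<tau>]], rule ccontr)
    fix i k assume ik: "i \<in> {1..n}" "k \<in> {1..n}" and lt: "\<sigma> i < \<sigma> k" and nl: "\<not> \<tau> i < \<tau> k"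
    have "i \<noteq> k" using lt by auto
    then have "\<tau> i \<noteq> \<tau> k" using permutes_inj[OF p(1)[OF \<tau>]] by (metis injD)
    then have gt: "\<tau> k < \<tau> i" using nl by simp
    have "block D (\<sigma> i) \<le> block D (\<sigma> k)" "block D (\<tau> k) \<le> block D (\<tau> i)"
      using block_mono[OF fin] lt gt by (simp_all add: less_imp_le)
    then have "block D (\<sigma> i) = block D (\<sigma> k)" "block D (\<tau> k) = block D (\<tau> i)"
      using b ik by auto
    from ord[OF \<sigma> ik this(1) lt] ord[OF \<tau> ik(2,1) this(2) gt] show False by simp
  qed
qed

text \<open>
  Sorting the cells of the table gives a word whose first components must be the blocks of \<open>J\<close> in order.
  Let \<open>v\<close> be the word of second components. Ranking the positions \<open>i\<close> by the pair \<open>(v i, \<pi> i)\<close> gives \<open>\<sigma>\<close>;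
  the column sums force \<open>v i\<close> to be the block of \<open>\<sigma> i\<close>.
\<close>

lemma factors_surj:
  assumes n: "1 \<le> n" and J: "J \<subseteq> {1..n - 1}" and D: "D \<subseteq> {1..n - 1}" and \<pi>: "\<pi> \<in> sym_grp n"
    and M: "M \<in> tables n J D" and fits: "fits n \<pi> M"
  shows "\<exists>\<sigma> \<in> factors n J D \<pi>. content n (cell n J D \<sigma>) = M"
proof -
  have fin: "finite J" "finite D" using J D finite_subset by blast+
  have p\<pi>: "\<pi> permutes {1..n}" using \<pi> by (simp add: sym_grp_def)
  have lt: "block D x < n" for x using block_less[OF n D] .
  obtain \<rho> where \<rho>: "\<rho> permutes {1..n}" "M = content n (cell n J D \<rho>)"
    using M by (auto simp: tables_def sym_grp_def)
  obtain g where g: "mono_on {1..n} g" "content n g = M" "fibrewise_increasing n g \<pi>"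
    using fits by (auto simp: fits_def)
  have "content n (\<lambda>i. g i div n) = content n (\<lambda>i. cell n J D \<rho> i div n)"
    using arg_cong[OF trans[OF g(2) \<rho>(2)], of "image_mset (\<lambda>x. x div n)"] by (simp only: image_mset_content)
  also have "\<dots> = content n (block J)" using lt n by (intro content_cong) (simp add: cell_def)
  finally have contJ: "content n (\<lambda>i. g i div n) = content n (block J)" .
  have row: "g i div n = block J i" if "i \<in> {1..n}" for i
    using g(1) block_mono[OF fin(1)]
    by (intro mono_content_unique[OF _ _ contJ that]) (auto intro!: mono_onI div_le_mono dest: mono_onD)
  define v where "v i = g i mod n" for i
  have gv: "g i = block J i * n + v i" if "i \<in> {1..n}" for i
    using row[OF that] div_mult_mod_eq[of "g i" n] by (simp add: v_def)
  have "content n v = content n (\<lambda>i. cell n J D \<rho> i mod n)"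
    using arg_cong[OF trans[OF g(2) \<rho>(2)], of "image_mset (\<lambda>x. x mod n)"]
    by (simp only: image_mset_content v_def[abs_def])
  also have "\<dots> = content n (\<lambda>i. block D (\<rho> i))" using lt by (intro content_cong) (simp add: cell_def)
  also have "\<dots> = content n (block D)" by (rule content_permute[OF \<rho>(1)])
  finally have contD: "content n v = content n (block D)" .
  \<comment> \<open>The values of \<open>\<pi>\<close> are at most \<open>n\<close>, so the factor \<open>n + 1\<close> makes \<open>e\<close> order the pairs \<open>(v i, \<pi> i)\<close> lexicographically.\<close>
  define e where "e i = v i * (n + 1) + \<pi> i" for i
  have \<pi>_le: "\<pi> i < n + 1" if "i \<in> {1..n}" for i using permutes_in_range[OF p\<pi> that] by simp
  have e_less: "e i < e k \<longleftrightarrow> v i < v k \<or> v i = v k \<and> \<pi> i < \<pi> k"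
    if "i \<in> {1..n}" "k \<in> {1..n}" for i k
    using code_less[OF \<pi>_le[OF that(1)], of "v i" "v k" "\<pi> k"]
      code_less[OF \<pi>_le[OF that(2)], of "v k" "v i" "\<pi> i"]
    unfolding e_def by (cases "v i" "v k" rule: linorder_cases) auto
  have "inj_on e {1..n}"
  proof (rule inj_onI)
    fix i k assume ik: "i \<in> {1..n}" "k \<in> {1..n}" "e i = e k"
    then have "\<pi> i = \<pi> k" using e_less[OF ik(1,2)] e_less[OF ik(2,1)] by (metis nat_neq_iff)
    then show "i = k" using permutes_inj[OF p\<pi>] by (simp add: inj_eq)
  qed
  then obtain \<sigma> where \<sigma>: "\<sigma> permutes {1..n}"
    and \<sigma>_less: "\<And>i k. i \<in> {1..n} \<Longrightarrow> k \<in> {1..n} \<Longrightarrow> \<sigma> i < \<sigma> k \<longleftrightarrow> e i < e k"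
    using ranking_permutation by blast
  have inv: "inv \<sigma> permutes {1..n}" using permutes_inv[OF \<sigma>] .
  have v_mono: "v i \<le> v k" if "i \<in> {1..n}" "k \<in> {1..n}" "\<sigma> i \<le> \<sigma> k" for i k
    using \<sigma>_less[OF that(2,1)] e_less[OF that(2,1)] that(3) by fastforce
  have "mono_on {1..n} (\<lambda>a. v (inv \<sigma> a))"
    using v_mono permutes_in_range[OF inv] permutes_inverses[OF \<sigma>] by (intro mono_onI) simp
  then have "v (inv \<sigma> a) = block D a" if "a \<in> {1..n}" for a
    using block_mono[OF fin(2)] content_permute[OF inv, of v] contD
    by (intro mono_content_unique[OF _ _ _ that]) (auto intro!: mono_onI)
  then have v_block: "v i = block D (\<sigma> i)" if "i \<in> {1..n}" for i
    using permutes_in_range[OF \<sigma> that] permutes_inverses[OF \<sigma>] by metis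
  have "fibrewise_increasing n (block J) \<sigma>"
    unfolding fibrewise_increasing_def
  proof (intro ballI impI)
    fix i k assume ik: "i \<in> {1..n}" "k \<in> {1..n}" "i < k" and b: "block J i = block J k"
    have "g i \<le> g k" using mono_onD[OF g(1) ik(1,2)] ik(3) by simp
    then have "v i \<le> v k" using gv ik b by simp
    moreover have "\<pi> i < \<pi> k" if "v i = v k"
    proof -
      have "g i = g k" using gv ik b that by simp
      then have "\<pi> i \<le> \<pi> k" using g(3) ik by (simp add: fibrewise_increasing_def)
      moreover have "\<pi> i \<noteq> \<pi> k" using ik(3) permutes_inj[OF p\<pi>] by (metis injD less_irrefl)
      ultimately show ?thesis by simp
    qed
    ultimately have "e i < e k" using e_less[OF ik(1,2)] by linarith
    then show "\<sigma> i \<le> \<sigma> k" using \<sigma>_less[OF ik(1,2)] by simp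
  qed
  moreover have "fibrewise_increasing n (block D) (\<pi> \<circ> inv \<sigma>)"
    unfolding fibrewise_increasing_def
  proof (intro ballI impI)
    fix a c assume ac: "a \<in> {1..n}" "c \<in> {1..n}" "a < c" and b: "block D a = block D c"
    let ?i = "inv \<sigma> a" and ?k = "inv \<sigma> c"
    have ik: "?i \<in> {1..n}" "?k \<in> {1..n}" using permutes_in_range[OF inv] ac by blast+
    have s: "\<sigma> ?i = a" "\<sigma> ?k = c" using permutes_inverses[OF \<sigma>] by auto
    have "e ?i < e ?k" using \<sigma>_less[OF ik] s ac(3) by simp
    moreover have "v ?i = v ?k" using v_block[OF ik(1)] v_block[OF ik(2)] s b by simp
    ultimately show "(\<pi> \<circ> inv \<sigma>) a \<le> (\<pi> \<circ> inv \<sigma>) c" using e_less[OF ik] by simp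
  qed
  ultimately have "\<sigma> \<in> factors n J D \<pi>"
    using \<sigma> by (auto simp: factors_def sym_grp_def Des_subset_iff_block[OF J] Des_subset_iff_block[OF D])
  moreover have "content n (cell n J D \<sigma>) = M"
    using content_cong[of n "cell n J D \<sigma>" g] gv v_block g(2) by (simp add: cell_def)
  ultimately show ?thesis by blast
qed

lemma card_factors:
  assumes n: "1 \<le> n" and J: "J \<subseteq> {1..n - 1}" and D: "D \<subseteq> {1..n - 1}" and \<pi>: "\<pi> \<in> sym_grp n"
  shows "card (factors n J D \<pi>) = card {M \<in> tables n J D. fits n \<pi> M}"
proof (rule bij_betw_same_card)
  let ?c = "\<lambda>\<sigma>. content n (cell n J D \<sigma>)"
  have "?c \<sigma> \<in> {M \<in> tables n J D. fits n \<pi> M}" if "\<sigma> \<in> factors n J D \<pi>" for \<sigma>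
    using that cell_mono_and_fibrewise_increasing[OF assms that] by (auto simp: tables_def fits_def factors_def)
  then have "?c ` factors n J D \<pi> = {M \<in> tables n J D. fits n \<pi> M}"
    using factors_surj[OF assms] by auto
  then show "bij_betw ?c (factors n J D \<pi>) {M \<in> tables n J D. fits n \<pi> M}"
    using inj_on_factors[OF assms] by (simp add: bij_betw_def)
qed

section \<open>Coefficients of fundamental quasisymmetric functions\<close>

definition monom_of :: "nat multiset \<Rightarrow> monom" where
  "monom_of M = (\<Sum>x\<in>#M. Poly_Mapping.single x 1)"

lemma lookup_monom_of: "Poly_Mapping.lookup (monom_of M) x = count M x"
  by (induction M) (simp_all add: monom_of_def lookup_add lookup_single when_def)

lemma keys_monom_of: "Poly_Mapping.keys (monom_of M) = set_mset M"
  by (auto simp: in_keys_iff lookup_monom_of)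

text \<open>
  The unique composition whose monomial quasisymmetric function contains \<open>m\<close>.
\<close>

definition exponents :: "monom \<Rightarrow> nat list" where
  "exponents m = map (Poly_Mapping.lookup m) (sorted_list_of_set (Poly_Mapping.keys m))"

lemma monomial_qsym_eq:
  assumes pos: "\<forall>a \<in> set \<beta>. 0 < a"
  shows "monomial_qsym \<beta> m = (if \<beta> = exponents m then 1 else 0)"
proof -
  let ?mon = "\<lambda>ks. \<Sum>k<length \<beta>. Poly_Mapping.single (ks ! k) (\<beta> ! k)"
  let ?xs = "sorted_list_of_set (Poly_Mapping.keys m)"
  have hit: "Poly_Mapping.lookup (?mon ks) (ks ! k) = \<beta> ! k"
    if "length ks = length \<beta>" "sorted_wrt (<) ks" "k < length \<beta>" for ks :: "nat list" and k
  proof -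
    have "distinct ks" using that(2) by (simp add: strict_sorted_iff)
    then have "Poly_Mapping.lookup (?mon ks) (ks ! k) = (\<Sum>l<length \<beta>. if l = k then \<beta> ! k else 0)"
      unfolding lookup_sum using that
      by (intro sum.cong) (auto simp: lookup_single when_def nth_eq_iff_index_eq)
    then show ?thesis using that(3) by simp
  qed
  have miss: "Poly_Mapping.lookup (?mon ks) x = 0"
    if "length ks = length \<beta>" "x \<notin> set ks" for ks :: "nat list" and x
    unfolding lookup_sum using that by (intro sum.neutral) (auto simp: lookup_single when_def)
  have "{ks. length ks = length \<beta> \<and> sorted_wrt (<) ks \<and> ?mon ks = m}
    = (if \<beta> = exponents m then {?xs} else {})" (is "?S = _")
  proof -
    have only: "ks = ?xs \<and> \<beta> = exponents m" if "ks \<in> ?S" for ks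
    proof -
      have ks: "length ks = length \<beta>" "sorted_wrt (<) ks" "?mon ks = m" using that by auto
      have "x \<in> set ks \<longleftrightarrow> Poly_Mapping.lookup m x \<noteq> 0" for x
        using hit[OF ks(1,2)] miss[OF ks(1)] pos ks(1,3)
        by (metis in_set_conv_nth nth_mem less_irrefl)
      then have "Poly_Mapping.keys m = set ks" by (auto simp: in_keys_iff)
      then have "?xs = ks"
        using ks(2) by (simp add: sorted_list_of_set.idem_if_sorted_distinct strict_sorted_iff)
      moreover have "\<beta> = map (Poly_Mapping.lookup m) ks"
        using hit[OF ks(1,2)] ks(1,3) by (intro nth_equalityI) auto
      ultimately show ?thesis by (simp add: exponents_def)
    qed
    have mem: "?xs \<in> ?S" if "\<beta> = exponents m"
    proof -
      have l: "length ?xs = length \<beta>" and s: "sorted_wrt (<) ?xs"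
        by (simp_all add: that exponents_def strict_sorted_iff)
      have "?mon ?xs = m"
      proof (rule poly_mapping_eqI)
        fix x
        show "Poly_Mapping.lookup (?mon ?xs) x = Poly_Mapping.lookup m x"
        proof (cases "x \<in> set ?xs")
          case True
          then obtain k where k: "k < length \<beta>" "x = ?xs ! k" using l by (metis in_set_conv_nth)
          then have "\<beta> ! k = Poly_Mapping.lookup m x" using l unfolding that exponents_def by simp
          then show ?thesis using hit[OF l s k(1)] k(2) by simp
        next
          case False
          then show ?thesis using miss[OF l False] by (simp add: in_keys_iff)
        qed
      qed
      then show ?thesis using l s by simp
    qed
    show ?thesis
    proof (cases "\<beta> = exponents m")
      case True
      have "?S = {?xs}"
      proof (intro equalityI subsetI)
        fix ks assume "ks \<in> ?S"
        from only[OF this] show "ks \<in> {?xs}" by blast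
      next
        fix ks assume "ks \<in> {?xs}"
        then show "ks \<in> ?S" using mem[OF True] by (simp only: singleton_iff)
      qed
      then show ?thesis unfolding if_P[OF True] .
    next
      case False
      have "?S = {}"
      proof (rule equals0I)
        fix ks assume "ks \<in> ?S"
        from only[OF this] show False using False by blast
      qed
      then show ?thesis unfolding if_not_P[OF False] .
    qed
  qed
  then have "card {ks \<in> {ks. length ks = length \<beta> \<and> sorted_wrt (<) ks}. ?mon ks = m}
    = (if \<beta> = exponents m then 1 else 0)"
    by (simp add: conj_assoc)
  then show ?thesis unfolding monomial_qsym_def monom_sum_def by simp
qed

lemma finite_compositions: "finite (compositions n)"
proof (rule finite_subset)
  have "length \<alpha> \<le> sum_list \<alpha>" if "\<forall>a \<in> set \<alpha>. 0 < a" for \<alpha> :: "nat list"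
    using that by (induction \<alpha>) auto
  then show "compositions n \<subseteq> {\<alpha>. set \<alpha> \<subseteq> {0..n} \<and> length \<alpha> \<le> n}"
    using member_le_sum_list by (fastforce simp: compositions_def)
  show "finite {\<alpha>. set \<alpha> \<subseteq> {0..n} \<and> length \<alpha> \<le> n}" by (rule finite_lists_length_le) simp
qed

lemma fundamental_qsym_eq:
  "fundamental_qsym \<alpha> m =
    (if sum_list (exponents m) = sum_list \<alpha> \<and> refines (exponents m) \<alpha> then 1 else 0)"
proof -
  let ?R = "{\<beta> \<in> compositions (sum_list \<alpha>). refines \<beta> \<alpha>}"
  have pos: "\<forall>a \<in> set (exponents m). 0 < a" by (auto simp: exponents_def in_keys_iff)
  have "fundamental_qsym \<alpha> m = (\<Sum>\<beta>\<in>?R. if \<beta> = exponents m then 1 else 0)"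
    unfolding fundamental_qsym_def
    by (rule sum.cong) (auto simp: compositions_def monomial_qsym_eq)
  also have "\<dots> = (if exponents m \<in> ?R then 1 else 0)"
    using finite_compositions[of "sum_list \<alpha>"] by (simp add: sum.delta)
  finally show ?thesis using pos by (simp add: compositions_def)
qed

lemma refines_single: "refines \<beta> [a] \<longleftrightarrow> sum_list \<beta> = a"
proof
  assume "refines \<beta> [a]"
  then obtain bs where "concat bs = \<beta>" "map sum_list bs = [a]" unfolding refines_def by (elim exE conjE)
  then show "sum_list \<beta> = a" by (cases bs) auto
next
  assume "sum_list \<beta> = a"
  then show "refines \<beta> [a]" unfolding refines_def by (intro exI[of _ "[\<beta>]"]) simp
qed

lemma refines_Cons:
  "refines \<beta> (a # \<alpha>) \<longleftrightarrow> (\<exists>k. sum_list (take k \<beta>) = a \<and> refines (drop k \<beta>) \<alpha>)"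
proof
  assume "refines \<beta> (a # \<alpha>)"
  then obtain b bs where "b @ concat bs = \<beta>" "sum_list b = a" "map sum_list bs = \<alpha>"
    unfolding refines_def by (fastforce simp: map_eq_Cons_conv)
  then show "\<exists>k. sum_list (take k \<beta>) = a \<and> refines (drop k \<beta>) \<alpha>"
    unfolding refines_def by (intro exI[of _ "length b"]) auto
next
  assume "\<exists>k. sum_list (take k \<beta>) = a \<and> refines (drop k \<beta>) \<alpha>"
  then obtain k bs where "sum_list (take k \<beta>) = a" "concat bs = drop k \<beta>" "map sum_list bs = \<alpha>"
    unfolding refines_def by auto
  then show "refines \<beta> (a # \<alpha>)"
    unfolding refines_def by (intro exI[of _ "take k \<beta> # bs"]) simp
qed

lemma sum_list_take_add: "sum_list (take (k + l) \<beta>) = sum_list (take k \<beta>) + sum_list (take l (drop k \<beta>))"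
  for \<beta> :: "nat list"
  by (simp add: take_add)

text \<open>
  Refinement is inclusion of sets of partial sums. The offset \<open>p\<close> makes the induction on \<open>js\<close> work: it is
  the partial sum up to the part that is split off.
\<close>

lemma refines_differences:
  fixes \<beta> js :: "nat list"
  assumes "sorted_wrt (<) (p # js @ [q])"
  shows "refines \<beta> (map2 (-) (js @ [q]) (p # js)) \<longleftrightarrow>
    p + sum_list \<beta> = q \<and> (\<forall>j \<in> set js. \<exists>k. p + sum_list (take k \<beta>) = j)"
  using assms
proof (induction js arbitrary: p \<beta>)
  case Nil
  then show ?case by (auto simp: refines_single)
next
  case (Cons j js)
  have pj: "p < j" "\<forall>i \<in> set js. j < i" using Cons.prems by auto
  have IH: "refines \<gamma> (map2 (-) (js @ [q]) (j # js)) \<longleftrightarrow>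
    j + sum_list \<gamma> = q \<and> (\<forall>i \<in> set js. \<exists>k. j + sum_list (take k \<gamma>) = i)" for \<gamma>
    by (rule Cons.IH) (use Cons.prems in simp)
  have split: "sum_list \<beta> = sum_list (take k \<beta>) + sum_list (drop k \<beta>)" for k
    using sum_list_append[of "take k \<beta>" "drop k \<beta>"] by simp
  have "(\<exists>k. sum_list (take k \<beta>) = j - p \<and> j + sum_list (drop k \<beta>) = q \<and>
      (\<forall>i \<in> set js. \<exists>l. j + sum_list (take l (drop k \<beta>)) = i)) \<longleftrightarrow>
    p + sum_list \<beta> = q \<and> (\<exists>k. p + sum_list (take k \<beta>) = j) \<and>
      (\<forall>i \<in> set js. \<exists>l. p + sum_list (take l \<beta>) = i)" (is "?L \<longleftrightarrow> ?R")
  proof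
    assume ?L
    then obtain k where k: "sum_list (take k \<beta>) = j - p" "j + sum_list (drop k \<beta>) = q"
      "\<forall>i \<in> set js. \<exists>l. j + sum_list (take l (drop k \<beta>)) = i" by (elim exE conjE)
    have "\<exists>l. p + sum_list (take l \<beta>) = i" if i: "i \<in> set js" for i
    proof -
      obtain l where "j + sum_list (take l (drop k \<beta>)) = i" using bspec[OF k(3) i] by (elim exE)
      then have "p + sum_list (take (k + l) \<beta>) = i" using k(1) pj(1) by (simp add: sum_list_take_add)
      then show ?thesis by blast
    qed
    then have "\<forall>i \<in> set js. \<exists>l. p + sum_list (take l \<beta>) = i" by (rule ballI)
    moreover have "\<exists>k. p + sum_list (take k \<beta>) = j" using k(1) pj(1) by (intro exI[of _ k]) simp
    moreover have "p + sum_list \<beta> = q" using k(1,2) pj(1) split[of k] by simp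
    ultimately show ?R by (intro conjI)
  next
    assume R: ?R
    from R obtain k where k: "p + sum_list (take k \<beta>) = j" by (elim conjE exE)
    have "\<exists>l. j + sum_list (take l (drop k \<beta>)) = i" if i: "i \<in> set js" for i
    proof -
      obtain l where l: "p + sum_list (take l \<beta>) = i" using R i by fast
      have "k \<le> l"
      proof (rule ccontr)
        assume "\<not> k \<le> l"
        then have "sum_list (take k \<beta>) = sum_list (take l \<beta>) + sum_list (take (k - l) (drop l \<beta>))"
          using sum_list_take_add[of l "k - l" \<beta>] by simp
        then show False using k l bspec[OF pj(2) i] by simp
      qed
      then have "j + sum_list (take (l - k) (drop k \<beta>)) = i"
        using sum_list_take_add[of k "l - k" \<beta>] k l by simp
      then show ?thesis by blast
    qed
    then have "\<forall>i \<in> set js. \<exists>l. j + sum_list (take l (drop k \<beta>)) = i" by (rule ballI)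
    moreover have "sum_list (take k \<beta>) = j - p" using k by simp
    moreover have "j + sum_list (drop k \<beta>) = q" using R k split[of k] by simp
    ultimately show ?L by (intro exI[of _ k] conjI)
  qed
  then show ?case by (simp add: refines_Cons IH)
qed

lemma refines_co:
  assumes "1 \<le> n" "S \<subseteq> {1..n - 1}"
  shows "refines \<beta> (co n S) \<longleftrightarrow> sum_list \<beta> = n \<and> (\<forall>s \<in> S. \<exists>k. sum_list (take k \<beta>) = s)"
proof -
  have f: "finite S" using assms(2) finite_subset by blast
  have "sorted_wrt (<) (0 # sorted_list_of_set S @ [n])"
    using assms f by (fastforce simp: sorted_wrt_append)
  from refines_differences[OF this, of \<beta>] show ?thesis
    using f by (simp add: co_def Let_def)
qed

lemma refines_sum_list:
  fixes \<alpha> \<beta> :: "nat list"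
  assumes "refines \<beta> \<alpha>" shows "sum_list \<beta> = sum_list \<alpha>"
proof -
  obtain bs where "concat bs = \<beta>" "map sum_list bs = \<alpha>" using assms unfolding refines_def by (elim exE conjE)
  moreover have "sum_list (concat bs) = sum_list (map sum_list bs)" by (induction bs) simp_all
  ultimately show ?thesis by simp
qed

lemma take_eq_filter_less:
  fixes xs :: "nat list"
  assumes "sorted_wrt (<) xs"
  shows "\<exists>t. take k xs = filter (\<lambda>x. x < t) xs"
  using assms
proof (induction xs arbitrary: k)
  case (Cons x xs)
  show ?case
  proof (cases k)
    case 0
    then show ?thesis by (intro exI[of _ 0]) simp
  next
    case (Suc l)
    obtain t where t: "take l xs = filter (\<lambda>x. x < t) xs" using Cons by fastforce
    have "filter (\<lambda>y. y < max t (Suc x)) xs = filter (\<lambda>x. x < t) xs"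
      using Cons.prems by (intro filter_cong) auto
    then show ?thesis using t Suc by (intro exI[of _ "max t (Suc x)"]) simp
  qed
qed simp

lemma filter_less_eq_take:
  fixes xs :: "nat list"
  assumes "sorted_wrt (<) xs"
  shows "filter (\<lambda>x. x < t) xs = take (length (filter (\<lambda>x. x < t) xs)) xs"
  using assms
proof (induction xs)
  case (Cons x xs)
  show ?case
  proof (cases "x < t")
    case False
    then have "filter (\<lambda>x. x < t) xs = []" using Cons.prems by (auto simp: filter_empty_conv)
    then show ?thesis using False by simp
  qed (use Cons in simp)
qed simp

text \<open>
  The exponents are listed by increasing letter, and an initial stretch of an increasing list consists of
  the letters below some threshold.
\<close>

lemma partial_sums_exponents:
  "(\<exists>k. sum_list (take k (exponents (monom_of M))) = s) \<longleftrightarrow> (\<exists>t. size {#x \<in># M. x < t#} = s)"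
proof -
  let ?xs = "sorted_list_of_set (set_mset M)"
  have sorted: "sorted_wrt (<) ?xs" by (simp add: strict_sorted_iff)
  have "sum_list (map (count M) (filter (\<lambda>x. x < t) ?xs)) = size {#x \<in># M. x < t#}" for t
  proof -
    have "sum_list (map (count M) (filter (\<lambda>x. x < t) ?xs)) = sum (count M) {x \<in> set_mset M. x < t}"
      by (subst sum_list_distinct_conv_sum_set) simp_all
    also have "\<dots> = size {#x \<in># M. x < t#}"
      by (simp add: size_multiset_overloaded_eq)
    finally show ?thesis .
  qed
  moreover have "exponents (monom_of M) = map (count M) ?xs"
    by (simp add: exponents_def keys_monom_of lookup_monom_of)
  ultimately show ?thesis
    using take_eq_filter_less[OF sorted] filter_less_eq_take[OF sorted]
    by (metis take_map)
qed

lemma sum_list_exponents: "sum_list (exponents (monom_of M)) = size M"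
  by (simp add: exponents_def keys_monom_of lookup_monom_of sum_list_distinct_conv_sum_set
      size_multiset_overloaded_eq)

text \<open>
  The letters below a threshold occupy an initial segment of the positions; if the word increases strictly
  after position \<open>s\<close>, the threshold \<open>g (s + 1)\<close> separates its first \<open>s\<close> letters from the others.
\<close>

lemma strict_iff_count:
  fixes g :: "nat \<Rightarrow> nat"
  assumes g: "mono_on {1..n} g" and s: "s \<in> {1..n - 1}"
  shows "g s < g (s + 1) \<longleftrightarrow> (\<exists>t. card {i \<in> {1..n}. g i < t} = s)"
proof -
  have r: "s \<in> {1..n}" "s + 1 \<in> {1..n}" using s by auto
  note c = less_iff_le_count[OF g r(1)] less_iff_le_count[OF g r(2)]
  show ?thesis
  proof
    assume "g s < g (s + 1)"
    then have "card {i \<in> {1..n}. g i < g (s + 1)} = s"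
      using c[of "g (s + 1)"] by linarith
    then show "\<exists>t. card {i \<in> {1..n}. g i < t} = s" by blast
  next
    assume "\<exists>t. card {i \<in> {1..n}. g i < t} = s"
    then obtain t where "card {i \<in> {1..n}. g i < t} = s" by blast
    then show "g s < g (s + 1)" using c[of t] by linarith
  qed
qed

text \<open>
  The coefficient is 1 exactly if each descent of \<open>\<pi>\<close> is a partial sum of the exponents, that is, if the
  sorted word with these letters increases strictly at each descent of \<open>\<pi>\<close>.
\<close>

lemma fundamental_qsym_coeff:
  assumes n: "1 \<le> n" and M: "size M = n"
  shows "fundamental_qsym (co n (Des n \<pi>)) (monom_of M) = (if fits n \<pi> M then 1 else 0)"
proof -
  have D: "Des n \<pi> \<subseteq> {1..n - 1}" by (auto simp: Des_def)
  have eq: "fibrewise_increasing n g \<pi> \<longleftrightarrow> (\<forall>s \<in> Des n \<pi>. \<exists>t. size {#x \<in># M. x < t#} = s)"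
    if g: "mono_on {1..n} g" "content n g = M" for g
    unfolding fibrewise_increasing_iff[OF g(1)] g(2)[symmetric] size_filter_content
    using strict_iff_count[OF g(1)] D by blast
  have "fits n \<pi> M \<longleftrightarrow> (\<forall>s \<in> Des n \<pi>. \<exists>t. size {#x \<in># M. x < t#} = s)"
    using eq mono_content_exists[OF M] unfolding fits_def by blast
  also have "\<dots> \<longleftrightarrow> refines (exponents (monom_of M)) (co n (Des n \<pi>))"
    unfolding refines_co[OF n D] partial_sums_exponents sum_list_exponents using M by simp
  finally show ?thesis
    using refines_sum_list unfolding fundamental_qsym_eq by auto
qed

section \<open>Transposing tables\<close>

text \<open>
  On codes of cells this exchanges the two components. Fixing all other numbers makes it a permutation
  of all variables, as the symmetry of a power series requires.
\<close>

definition transpose_code :: "nat \<Rightarrow> nat \<Rightarrow> nat" where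
  "transpose_code n x = (if x < n * n then (x mod n) * n + x div n else x)"

lemma transpose_code_cell:
  assumes "j < n" "d < n" shows "transpose_code n (j * n + d) = d * n + j"
proof -
  have "j * n + d < n * n + 0" using assms by (intro code_less)
  then show ?thesis using assms by (simp add: transpose_code_def)
qed

lemma transpose_code_involutive: "transpose_code n (transpose_code n x) = x"
proof (cases "x < n * n")
  case True
  then have "0 < n" by (cases n) auto
  then have "x mod n < n" "x div n < n" using True by (simp_all add: less_mult_imp_div_less)
  then show ?thesis
    using transpose_code_cell[of "x mod n" n "x div n"] True by (simp add: transpose_code_def)
qed (simp add: transpose_code_def)

lemma bij_transpose_code: "bij (transpose_code n)"
  using transpose_code_involutive by (rule involuntory_imp_bij)

text \<open>
  \<open>Poly_Mapping.map_key\<close> precomposes with \<open>f\<close>, while \<open>image_mset\<close> pushes forward along \<open>f\<close>; the two agree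
  for an involution.
\<close>

lemma map_key_monom_of:
  assumes "\<And>x. f (f x) = x"
  shows "Poly_Mapping.map_key f (monom_of M) = monom_of (image_mset f M)"
proof (rule poly_mapping_eqI)
  fix x
  have inj: "inj f" using involuntory_imp_bij[OF assms] by (rule bij_is_inj)
  have "count (image_mset f M) (f (f x)) = count M (f x)"
    by (induction M) (simp_all add: inj_eq[OF inj])
  then show "Poly_Mapping.lookup (Poly_Mapping.map_key f (monom_of M)) x =
      Poly_Mapping.lookup (monom_of (image_mset f M)) x"
    by (simp add: map_key.rep_eq[OF inj] lookup_monom_of assms)
qed

text \<open>
  If \<open>\<sigma>\<close> yields a table, then reindexing the positions by \<open>\<sigma>\<close> shows that \<open>inv \<sigma>\<close> yields its transpose.
\<close>

lemma transpose_tables_subset: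
  assumes n: "1 \<le> n" and J: "J \<subseteq> {1..n - 1}" and D: "D \<subseteq> {1..n - 1}" and M: "M \<in> tables n J D"
  shows "image_mset (transpose_code n) M \<in> tables n D J"
proof -
  obtain \<sigma> where \<sigma>: "\<sigma> permutes {1..n}" "M = content n (cell n J D \<sigma>)"
    using M by (auto simp: tables_def sym_grp_def)
  have "image_mset (transpose_code n) M = content n (\<lambda>i. cell n D J (inv \<sigma>) (\<sigma> i))"
    unfolding \<sigma>(2) image_mset_content
    by (rule content_cong)
      (simp add: cell_def transpose_code_cell block_less[OF n J] block_less[OF n D]
        permutes_inverses[OF \<sigma>(1)])
  also have "\<dots> = content n (cell n D J (inv \<sigma>))" by (rule content_permute[OF \<sigma>(1)])
  finally show ?thesis using permutes_inv[OF \<sigma>(1)] by (auto simp: tables_def sym_grp_def)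
qed

lemma bij_betw_transpose_tables:
  assumes n: "1 \<le> n" and J: "J \<subseteq> {1..n - 1}" and D: "D \<subseteq> {1..n - 1}"
  shows "bij_betw (image_mset (transpose_code n)) (tables n J D) (tables n D J)"
proof (rule bij_betw_byWitness)
  have "image_mset (transpose_code n) (image_mset (transpose_code n) M) = M" for M
    by (simp add: multiset.map_comp comp_def transpose_code_involutive)
  then show "\<forall>M \<in> tables n J D. image_mset (transpose_code n) (image_mset (transpose_code n) M) = M"
    "\<forall>M \<in> tables n D J. image_mset (transpose_code n) (image_mset (transpose_code n) M) = M"
    by blast+
  show "image_mset (transpose_code n) ` tables n J D \<subseteq> tables n D J"
    using transpose_tables_subset[OF n J D] by blast
  show "image_mset (transpose_code n) ` tables n D J \<subseteq> tables n J D"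
    using transpose_tables_subset[OF n D J] by blast
qed

lemma finite_sym_grp: "finite (sym_grp n)"
  by (simp add: sym_grp_def finite_permutations)

lemma finite_tables: "finite (tables n J D)"
  by (simp add: tables_def finite_sym_grp)

text \<open>
  At a table, the coefficient of a summand of \<open>Q(B)\<close> is 1 if the table comes from a factorisation and 0
  otherwise.
\<close>

lemma sum_card_factors:
  assumes n: "1 \<le> n" and J: "J \<subseteq> {1..n - 1}" and D: "D \<subseteq> {1..n - 1}" and B: "set_mset B \<subseteq> sym_grp n"
  shows "int (\<Sum>\<pi>\<in>#B. card (factors n J D \<pi>)) = (\<Sum>M\<in>tables n J D. qsym_mset n B (monom_of M))"
  using B
proof (induction B)
  case empty
  then show ?case by (simp add: qsym_mset_def)
next
  case (add \<pi> B)
  have "size M = n" if "M \<in> tables n J D" for M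
    using that by (auto simp: tables_def content_def)
  then have "(\<Sum>M\<in>tables n J D. fundamental_qsym (co n (Des n \<pi>)) (monom_of M))
      = (\<Sum>M\<in>tables n J D. if fits n \<pi> M then 1 else 0)"
    by (intro sum.cong fundamental_qsym_coeff[OF n] refl)
  also have "\<dots> = int (card {M \<in> tables n J D. fits n \<pi> M})"
    using finite_tables by (simp add: sum.If_cases Int_def)
  also have "\<dots> = int (card (factors n J D \<pi>))"
    using card_factors[OF n J D] add.prems by simp
  finally show ?case using add by (simp add: qsym_mset_def sum.distrib)
qed

text \<open>
  Transposition of tables is induced by a permutation of the variables, under which \<open>Q(B)\<close> is invariant.
\<close>

lemma sum_card_factors_commute:
  assumes n: "1 \<le> n" and J: "J \<subseteq> {1..n - 1}" and D: "D \<subseteq> {1..n - 1}" and B: "set_mset B \<subseteq> sym_grp n"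
    and sym: "symmetric_series (qsym_mset n B)"
  shows "(\<Sum>\<pi>\<in>#B. card (factors n J D \<pi>)) = (\<Sum>\<pi>\<in>#B. card (factors n D J \<pi>))"
proof -
  have "qsym_mset n B (monom_of (image_mset (transpose_code n) M)) = qsym_mset n B (monom_of M)" for M
    using sym bij_transpose_code unfolding symmetric_series_def
    by (simp flip: map_key_monom_of[OF transpose_code_involutive])
  then have "(\<Sum>M\<in>tables n D J. qsym_mset n B (monom_of M)) = (\<Sum>M\<in>tables n J D. qsym_mset n B (monom_of M))"
    using sum.reindex_bij_betw[OF bij_betw_transpose_tables[OF n J D],
        of "\<lambda>M. qsym_mset n B (monom_of M)"] by simp
  then show ?thesis
    using sum_card_factors[OF n J D B] sum_card_factors[OF n D J B] by linarith
qed

section \<open>Products with inverse descent classes\<close>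

lemma finite_inv_J_class: "finite (inv_J_class n J)"
proof -
  have "inv_J_class n J \<subseteq> inv ` sym_grp n" by (auto simp: inv_J_class_def)
  then show ?thesis using finite_sym_grp finite_subset by blast
qed

lemma card_right_products:
  assumes \<pi>: "\<pi> \<in> sym_grp n"
  shows "card {\<tau> \<in> inv_J_class n J. Des n (\<pi> \<circ> \<tau>) \<subseteq> D} = card (factors n J D \<pi>)"
proof -
  have "{\<tau> \<in> inv_J_class n J. Des n (\<pi> \<circ> \<tau>) \<subseteq> D} = inv ` factors n J D \<pi>"
    by (auto simp: inv_J_class_def factors_def)
  moreover have "inj_on inv (factors n J D \<pi>)"
    by (rule inj_onI) (metis (mono_tags, lifting) factors_def mem_Collect_eq permutes_inv_inv sym_grp_def)
  ultimately show ?thesis by (simp add: card_image)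
qed

text \<open>
  The product \<open>\<sigma> = \<tau> \<circ> \<pi>\<close> is itself a right factor of \<open>\<pi>\<close>, with left factor \<open>inv \<tau>\<close>. So the product carries
  the condition for \<open>D\<close>, and the left factor carries the condition for \<open>J\<close>: the roles are exchanged.
\<close>

lemma card_left_products:
  assumes \<pi>: "\<pi> \<in> sym_grp n"
  shows "card {\<tau> \<in> inv_J_class n J. Des n (\<tau> \<circ> \<pi>) \<subseteq> D} = card (factors n D J \<pi>)"
proof (rule bij_betw_same_card)
  have p: "\<pi> permutes {1..n}" using \<pi> by (simp add: sym_grp_def)
  let ?A = "{\<tau> \<in> inv_J_class n J. Des n (\<tau> \<circ> \<pi>) \<subseteq> D}"
  have class_iff: "\<tau> \<in> inv_J_class n J \<longleftrightarrow> \<tau> permutes {1..n} \<and> Des n (inv \<tau>) \<subseteq> J" for \<tau>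
    unfolding inv_J_class_def sym_grp_def
    by (auto simp: permutes_inv permutes_inv_inv intro!: exI[of _ "inv \<tau>"])
  have cancel: "\<tau> \<circ> \<pi> \<circ> inv \<pi> = \<tau>" "\<tau> \<circ> inv \<pi> \<circ> \<pi> = \<tau>" for \<tau> :: "nat \<Rightarrow> nat"
    using permutes_inv_o[OF p] by (simp_all add: o_assoc[symmetric])
  show "bij_betw (\<lambda>\<tau>. \<tau> \<circ> \<pi>) ?A (factors n D J \<pi>)"
  proof (rule bij_betw_byWitness[where f' = "\<lambda>\<sigma>. \<sigma> \<circ> inv \<pi>"])
    show "(\<lambda>\<tau>. \<tau> \<circ> \<pi>) ` ?A \<subseteq> factors n D J \<pi>"
    proof (rule image_subsetI)
      fix \<tau> assume \<tau>: "\<tau> \<in> ?A"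
      then have t: "\<tau> permutes {1..n}" by (simp add: class_iff)
      have "\<pi> \<circ> inv (\<tau> \<circ> \<pi>) = inv \<tau>"
        using permutes_inv_o[OF p] by (simp add: o_inv_distrib permutes_bij[OF t] permutes_bij[OF p] o_assoc)
      then show "\<tau> \<circ> \<pi> \<in> factors n D J \<pi>"
        using \<tau> permutes_compose[OF p t] by (simp add: class_iff factors_def sym_grp_def)
    qed
    show "(\<lambda>\<sigma>. \<sigma> \<circ> inv \<pi>) ` factors n D J \<pi> \<subseteq> ?A"
    proof (rule image_subsetI)
      fix \<sigma> assume \<sigma>: "\<sigma> \<in> factors n D J \<pi>"
      then have s: "\<sigma> permutes {1..n}" by (simp add: factors_def sym_grp_def)
      have "inv (\<sigma> \<circ> inv \<pi>) = \<pi> \<circ> inv \<sigma>"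
        using permutes_inv_inv[OF p]
        by (simp add: o_inv_distrib permutes_bij[OF s] permutes_bij[OF permutes_inv[OF p]])
      then show "\<sigma> \<circ> inv \<pi> \<in> ?A"
        using \<sigma> permutes_compose[OF permutes_inv[OF p] s] cancel by (simp add: class_iff factors_def)
    qed
  qed (simp_all add: cancel)
qed

lemma size_filter_eq_sum: "size (filter_mset P M) = (\<Sum>x\<in>#M. if P x then 1 else 0)"
  by (induction M) simp_all

lemma size_filter_mset_prod:
  "size (filter_mset P (mset_prod A B)) = (\<Sum>\<pi>\<in>#A. size {#\<tau> \<in># B. P (\<pi> \<circ> \<tau>)#})"
  by (induction A) (simp_all add: mset_prod_def filter_mset_image_mset comp_def)

lemma size_filter_mset_prod_swap:
  "size (filter_mset P (mset_prod A B)) = (\<Sum>\<tau>\<in>#B. size {#\<pi> \<in># A. P (\<pi> \<circ> \<tau>)#})"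
  unfolding size_filter_mset_prod unfolding size_filter_eq_sum by (rule sum_mset.swap)

lemma size_filter_products:
  assumes "finite R"
  shows "size (filter_mset P (mset_prod B (mset_set R))) = (\<Sum>\<pi>\<in>#B. card {\<tau> \<in> R. P (\<pi> \<circ> \<tau>)})"
    and "size (filter_mset P (mset_prod (mset_set R) B)) = (\<Sum>\<pi>\<in>#B. card {\<tau> \<in> R. P (\<tau> \<circ> \<pi>)})"
  using assms by (simp_all add: size_filter_mset_prod[of P B] size_filter_mset_prod_swap[of P _ B] filter_mset_mset_set)

section \<open>From counts to descent equivalence\<close>

text \<open>
  Moebius inversion over subsets, as an induction on \<open>D\<close>.
\<close>

lemma sizes_by_descents_eqI:
  assumes sub: "\<And>D. D \<subseteq> {1..n - 1} \<Longrightarrow>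
    size {#x \<in># X. Des n x \<subseteq> D#} = size {#x \<in># Y. Des n x \<subseteq> D#}"
  shows "size {#x \<in># X. Des n x = D#} = size {#x \<in># Y. Des n x = D#}"
proof (cases "D \<subseteq> {1..n - 1}")
  case False
  then have "Des n x \<noteq> D" for x by (auto simp: Des_def)
  then show ?thesis by simp
next
  case True
  have split: "size {#x \<in># Z. Des n x \<subseteq> E#} = (\<Sum>F\<in>Pow E. size {#x \<in># Z. Des n x = F#})"
    if "finite E" for Z E
    unfolding size_filter_eq_sum using that
    by (induction Z) (simp_all add: sum.distrib)
  have "finite D" using True finite_subset by blast
  then show ?thesis
    using True
  proof (induction D rule: finite_psubset_induct)
    case (psubset D)
    have "(\<Sum>E\<in>Pow D. size {#x \<in># Z. Des n x = E#})
      = size {#x \<in># Z. Des n x = D#} + (\<Sum>E\<in>Pow D - {D}. size {#x \<in># Z. Des n x = E#})" for Z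
      using psubset.hyps by (intro sum.remove) auto
    moreover have "(\<Sum>E\<in>Pow D - {D}. size {#x \<in># X. Des n x = E#})
      = (\<Sum>E\<in>Pow D - {D}. size {#x \<in># Y. Des n x = E#})"
      by (rule sum.cong) (use psubset in auto)
    ultimately show ?case
      using sub[OF psubset.prems] split[OF psubset.hyps] by simp
  qed
qed

text \<open>
  The copies with a given descent set are equinumerous on both sides; the bijections between these
  classes are glued together.
\<close>

lemma D_equivI:
  assumes sizes: "\<And>D. size {#x \<in># X. Des n x = D#} = size {#x \<in># Y. Des n x = D#}"
  shows "D_equiv n X Y"
proof -
  let ?fib = "\<lambda>Z D. {c \<in> mset_copies Z. Des n (fst c) = D}"
  have fib: "?fib Z D = (SIGMA x:{x \<in> set_mset Z. Des n x = D}. {..<count Z x})" for Z D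
    by (auto simp: mset_copies_def intro: count_inI)
  have fin: "finite (?fib Z D)" for Z D unfolding fib by (intro finite_SigmaI) auto
  have card: "card (?fib Z D) = size {#x \<in># Z. Des n x = D#}" for Z D
    unfolding fib by (subst card_SigmaI) (simp_all add: size_multiset_overloaded_eq)
  have "card (?fib X D) = card (?fib Y D)" for D using sizes by (simp only: card)
  then have "\<exists>h. bij_betw h (?fib X D) (?fib Y D)" for D
    by (rule finite_same_card_bij[OF fin fin])
  then have "\<forall>D. \<exists>h. bij_betw h (?fib X D) (?fib Y D)" by (rule allI)
  from choice[OF this] obtain h where "\<forall>D. bij_betw (h D) (?fib X D) (?fib Y D)" by (elim exE)
  then have h: "bij_betw (h D) (?fib X D) (?fib Y D)" for D by (rule spec)
  let ?f = "\<lambda>c. h (Des n (fst c)) c"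
  have f: "?f c \<in> ?fib Y (Des n (fst c))" if "c \<in> mset_copies X" for c
    using bij_betwE[OF h[of "Des n (fst c)"]] that by blast
  have "bij_betw ?f (mset_copies X) (mset_copies Y)"
  proof (rule bij_betw_imageI)
    show "inj_on ?f (mset_copies X)"
    proof (rule inj_onI)
      fix c d assume cd: "c \<in> mset_copies X" "d \<in> mset_copies X" "?f c = ?f d"
      then have "Des n (fst c) = Des n (fst d)" using f[OF cd(1)] f[OF cd(2)] by simp
      then show "c = d"
        using cd bij_betw_imp_inj_on[OF h[of "Des n (fst d)"]] by (auto dest: inj_onD)
    qed
    show "?f ` mset_copies X = mset_copies Y"
    proof (intro equalityI subsetI)
      fix d assume "d \<in> ?f ` mset_copies X"
      then show "d \<in> mset_copies Y" using f by blast
    next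
      fix d assume "d \<in> mset_copies Y"
      then have "d \<in> h (Des n (fst d)) ` ?fib X (Des n (fst d))"
        using bij_betw_imp_surj_on[OF h] by blast
      then obtain c where "c \<in> mset_copies X" "Des n (fst c) = Des n (fst d)" "d = h (Des n (fst d)) c"
        by blast
      then show "d \<in> ?f ` mset_copies X" by (intro image_eqI[of _ _ c]) simp_all
    qed
  qed
  moreover have "Des n (fst (?f c)) = Des n (fst c)" if "c \<in> mset_copies X" for c
    using f[OF that] by simp
  ultimately show ?thesis unfolding D_equiv_def by blast
qed

theorem corollary3p4:
  fixes n :: nat and B :: "(nat \<Rightarrow> nat) multiset"
  assumes "n \<ge> 1"
    and "set_mset B \<subseteq> sym_grp n"
    and "fine_mset n B"
  shows "\<forall>J. J \<subseteq> {1..n - 1} \<longrightarrow> D_commutative n B (mset_set (inv_J_class n J))"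
proof (intro allI impI)
  fix J assume J: "J \<subseteq> {1..n - 1}"
  let ?R = "mset_set (inv_J_class n J)"
  show "D_commutative n B ?R"
    unfolding D_commutative_def
  proof (intro D_equivI sizes_by_descents_eqI)
    fix D assume D: "D \<subseteq> {1..n - 1}"
    note products = size_filter_products[OF finite_inv_J_class]
    have right: "card {\<tau> \<in> inv_J_class n J. Des n (\<pi> \<circ> \<tau>) \<subseteq> D} = card (factors n J D \<pi>)"
      and left: "card {\<tau> \<in> inv_J_class n J. Des n (\<tau> \<circ> \<pi>) \<subseteq> D} = card (factors n D J \<pi>)"
      if "\<pi> \<in># B" for \<pi>
      using that assms(2) by (auto intro: card_right_products card_left_products)
    have "size {#x \<in># mset_prod B ?R. Des n x \<subseteq> D#} = (\<Sum>\<pi>\<in>#B. card (factors n J D \<pi>))"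
      unfolding products by (simp add: right cong: image_mset_cong)
    also have "\<dots> = (\<Sum>\<pi>\<in>#B. card (factors n D J \<pi>))"
      using sum_card_factors_commute[OF assms(1) J D assms(2)] assms(3) by (simp add: fine_mset_def)
    also have "\<dots> = size {#x \<in># mset_prod ?R B. Des n x \<subseteq> D#}"
      unfolding products by (simp add: left cong: image_mset_cong)
    finally show "size {#x \<in># mset_prod B ?R. Des n x \<subseteq> D#} = size {#x \<in># mset_prod ?R B. Des n x \<subseteq> D#}" .
  qed
qed

end
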